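(* Let $A\in\mathbb{R}^{n\times n}$ be symmetric positive definite, $b\in\mathbb{R}^n$, $c\in\mathbb{R}$, and $f(x)=\frac12x^TAx-b^Tx+c$ with unique minimizer $x_*$. Suppose that $A$ has either one single eigenvalue or only two distinct eigenvalues. Then, for any initial point $x_0\in\mathbb{R}^n$ (and any relaxation parameter $\theta\in(0,1]$ for RelaxME), the sequences $(x_k)$ generated by ME, RelaxME, and MomME converge to $x_*$ in at most one iteration; that is, for each of the three methods, either $x_0=x_*$ (and no iteration is performed) or $x_1=x_*$.
   Context: Notation: $\|\cdot\|$ is the Euclidean norm and $\nabla f(x)=Ax-b$. All three methods start from $x_0$ with $g_0=\nabla f(x_0)$ and, for $k=0,1,2,\dots$, as long as $g_k\neq0$, perform iteration $k$ as follows. - Compute $w_k=Ag_k$, $t_k=\dfrac{2\|g_k\|^2}{g_k^Tw_k}$, $y_k=x_k-t_kg_k$, $r_k=g_k-t_kw_k$. - If $g_k$ and $r_k$ are linearly dependent, set $\tilde x_{k+1}=\frac12(x_k+y_k)$, $x_{k+1}=\tilde x_{k+1}$, $g_{k+1}=\nabla f(\tilde x_{k+1})$, and stop. - If $g_k$ and $r_k$ are linearly independent, let $(\alpha_k,\beta_k)$ be the minimizer over $(\alpha,\beta)\in\mathbb{R}^2$ of $f(x_k+\alpha g_k+\beta r_k)$ and set $\tilde x_{k+1}=x_k+\alpha_kg_k+\beta_kr_k$. If $k=0$, set $x_1=\tilde x_1$ and $g_1=\nabla f(\tilde x_1)$. If $k\ge1$: - RelaxME with parameter $\theta\in(0,1]$: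 $x_{k+1}=(1-\theta)x_k+\theta\tilde x_{k+1}$ and $g_{k+1}=(1-\theta)g_k+\theta\nabla f(\tilde x_{k+1})$. - ME (method of ellipcenters): RelaxME with $\theta=1$, i.e. $x_{k+1}=\tilde x_{k+1}$ and $g_{k+1}=\nabla f(\tilde x_{k+1})$. - MomME: with $\tilde s_{k-1}=\tilde x_{k+1}-x_{k-1}$, $\tilde v_{k-1}=\nabla f(\tilde x_{k+1})-g_{k-1}$ and $\mu_k=\dfrac{\nabla f(\tilde x_{k+1})^T\tilde s_{k-1}}{\tilde s_{k-1}^T\tilde v_{k-1}}$, set $x_{k+1}=(1-\mu_k)\tilde x_{k+1}+\mu_kx_{k-1}$ and $g_{k+1}=(1-\mu_k)\nabla f(\tilde x_{k+1})+\mu_kg_{k-1}$. *)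

theory Defs
  imports "HOL-Analysis.Analysis"
begin

definition sym_pos_def :: "real ^ 'n ^ 'n \<Rightarrow> bool" where
  "sym_pos_def A \<longleftrightarrow> transpose A = A \<and> (\<forall>v. v \<noteq> 0 \<longrightarrow> v \<bullet> (A *v v) > 0)"

text \<open>Only real eigenvalues are collected; for symmetric matrices these are all of them.\<close>

definition eigenvalues :: "real ^ 'n ^ 'n \<Rightarrow> real set" where
  "eigenvalues A = {l. \<exists>v. v \<noteq> 0 \<and> A *v v = l *\<^sub>R v}"

definition quad :: "real ^ 'n ^ 'n \<Rightarrow> real ^ 'n \<Rightarrow> real \<Rightarrow> real ^ 'n \<Rightarrow> real" where
  "quad A b c x = (1/2) * (x \<bullet> (A *v x)) - b \<bullet> x + c"

definition grad :: "real ^ 'n ^ 'n \<Rightarrow> real ^ 'n \<Rightarrow> real ^ 'n \<Rightarrow> real ^ 'n" where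
  "grad A b x = A *v x - b"

abbreviation is_minimizer :: "('a \<Rightarrow> real) \<Rightarrow> 'a \<Rightarrow> bool" where
  "is_minimizer f x \<equiv> is_arg_min f (\<lambda>_. True) x"

text \<open>Linear dependence of the pair; the predicate \<^const>\<open>dependent\<close> on sets would
  not see a repeated vector.\<close>

definition lin_dep :: "'a::real_vector \<Rightarrow> 'a \<Rightarrow> bool" where
  "lin_dep u v \<longleftrightarrow> u = v \<or> dependent {u, v}"

text \<open>The state after \<open>k\<close> iterations: the point \<open>x\<^sub>k\<close>, the vector \<open>g\<^sub>k\<close> (updated
  together with \<open>x\<^sub>k\<close>, not recomputed as the gradient at \<open>x\<^sub>k\<close>), and whether the method
  has stopped explicitly.\<close>

record 'n state =
  pt :: "real ^ 'n"
  gr :: "real ^ 'n"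
  stopped :: bool

text \<open>One iteration; \<open>None\<close> means that no iteration is performed. The argument \<open>upd\<close> gives
  \<open>(x\<^sub>k\<^sub>+\<^sub>1, g\<^sub>k\<^sub>+\<^sub>1)\<close> from the trial point (the minimizer of \<open>f\<close> on the plane through \<open>x\<^sub>k\<close>
  spanned by \<open>g\<^sub>k\<close> and \<open>r\<^sub>k\<close>) in the linearly independent case.\<close>

definition iteration ::
  "real ^ 'n ^ 'n \<Rightarrow> real ^ 'n \<Rightarrow> real \<Rightarrow> (real ^ 'n \<Rightarrow> (real ^ 'n) \<times> (real ^ 'n)) \<Rightarrow>
   'n state \<Rightarrow> 'n state option" where
  "iteration A b c upd s =
    (if stopped s \<or> gr s = 0 then None
     else
       let x = pt s;
           g = gr s;
           w = A *v g;
           t = 2 * (norm g)\<^sup>2 / (g \<bullet> w);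
           y = x - t *\<^sub>R g;
           r = g - t *\<^sub>R w
       in if lin_dep g r then
            let xt = (1/2) *\<^sub>R (x + y)
            in Some \<lparr>pt = xt, gr = grad A b xt, stopped = True\<rparr>
          else
            let (\<alpha>, \<beta>) = (THE p. is_minimizer (\<lambda>(\<alpha>, \<beta>). quad A b c (x + \<alpha> *\<^sub>R g + \<beta> *\<^sub>R r)) p);
                xt = x + \<alpha> *\<^sub>R g + \<beta> *\<^sub>R r;
                (x', g') = upd xt
            in Some \<lparr>pt = x', gr = g', stopped = False\<rparr>)"

text \<open>A method is its rule, for \<open>k \<ge> 1\<close>, computing \<open>(x\<^sub>k\<^sub>+\<^sub>1, g\<^sub>k\<^sub>+\<^sub>1)\<close> from the states at
  \<open>k - 1\<close> and \<open>k\<close> and the trial point.\<close>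

type_synonym 'n rule =
  "real ^ 'n ^ 'n \<Rightarrow> real ^ 'n \<Rightarrow> 'n state \<Rightarrow> 'n state \<Rightarrow> real ^ 'n \<Rightarrow> (real ^ 'n) \<times> (real ^ 'n)"

definition RelaxME :: "real \<Rightarrow> 'n::finite rule" where
  "RelaxME \<theta> A b p s xt =
     ((1 - \<theta>) *\<^sub>R pt s + \<theta> *\<^sub>R xt, (1 - \<theta>) *\<^sub>R gr s + \<theta> *\<^sub>R grad A b xt)"

definition ME :: "'n::finite rule" where
  "ME = RelaxME 1"

definition MomME :: "'n::finite rule" where
  "MomME A b p s xt =
     (let st = xt - pt p;
          vt = grad A b xt - gr p;
          \<mu> = (grad A b xt \<bullet> st) / (st \<bullet> vt)
      in ((1 - \<mu>) *\<^sub>R xt + \<mu> *\<^sub>R pt p, (1 - \<mu>) *\<^sub>R grad A b xt + \<mu> *\<^sub>R gr p))"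

fun run :: "'n::finite rule \<Rightarrow> real ^ 'n ^ 'n \<Rightarrow> real ^ 'n \<Rightarrow> real \<Rightarrow> real ^ 'n \<Rightarrow> nat \<Rightarrow> 'n state option" where
  "run m A b c x0 0 = Some \<lparr>pt = x0, gr = grad A b x0, stopped = False\<rparr>"
| "run m A b c x0 (Suc 0) =
     Option.bind (run m A b c x0 0) (iteration A b c (\<lambda>xt. (xt, grad A b xt)))"
| "run m A b c x0 (Suc (Suc k)) =
     Option.bind (run m A b c x0 k) (\<lambda>p.
       Option.bind (run m A b c x0 (Suc k)) (\<lambda>s. iteration A b c (m A b p s) s))"

text \<open>The iterate \<open>x\<^sub>k\<close>; the value \<open>None\<close> means that the method ended before producing it.\<close>

definition iterate ::
  "'n::finite rule \<Rightarrow> real ^ 'n ^ 'n \<Rightarrow> real ^ 'n \<Rightarrow> real \<Rightarrow> real ^ 'n \<Rightarrow> nat \<Rightarrow> (real ^ 'n) option" where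
  "iterate m A b c x0 k = map_option pt (run m A b c x0 k)"

definition at_most_one_iteration ::
  "'n::finite rule \<Rightarrow> real ^ 'n ^ 'n \<Rightarrow> real ^ 'n \<Rightarrow> real \<Rightarrow> real ^ 'n \<Rightarrow> real ^ 'n \<Rightarrow> bool" where
  "at_most_one_iteration m A b c x0 xs \<longleftrightarrow>
     (x0 = xs \<and> (\<forall>k\<ge>1. iterate m A b c x0 k = None)) \<or>
     (iterate m A b c x0 1 = Some xs \<and> (\<forall>k\<ge>2. iterate m A b c x0 k = None))"

end

theory Submission
  imports Defs
begin

text \<open>
  Let \<open>g = \<nabla>f(x\<^sub>0)\<close> be nonzero; otherwise \<open>x\<^sub>0\<close> is the minimizer. A symmetric matrix
  whose eigenvalues all lie in \<open>{l, m}\<close> is annihilated by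
  \<open>(X - l)(X - m)\<close>. Hence \<open>A\<^sup>2g = (l + m) Ag - lm g\<close>, so the Newton step \<open>-A\<inverse>g\<close> equals
  \<open>(Ag - (l + m) g) / (lm)\<close> and lies in the plane spanned by \<open>g\<close> and \<open>Ag\<close>. The vector
  \<open>r = g - t Ag\<close> with \<open>t \<noteq> 0\<close> is a combination of \<open>g\<close> and \<open>Ag\<close> involving \<open>Ag\<close>, so if \<open>g\<close>
  and \<open>r\<close> are independent, they span the same plane. The minimizer of \<open>f\<close> on the search plane is
  then the global one, and it is reached in the first iteration. If \<open>g\<close> and \<open>r\<close> are dependent,
  then \<open>g\<close> is an eigenvector, say \<open>Ag = \<lambda>g\<close>; here \<open>t = 2/\<lambda>\<close>, and the midpoint \<open>x\<^sub>0 - g/\<lambda>\<close> of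
  \<open>x\<^sub>0\<close> and \<open>y\<^sub>0\<close> is the Newton point. In both cases the new gradient is zero, so that no second
  iteration takes place. The three methods differ only in their rule for \<open>k \<ge> 1\<close>, so one
  argument serves for all of them.

  The annihilating polynomial is obtained without diagonalizing \<open>A\<close>. A nonzero invariant subspace
  of a symmetric matrix contains an eigenvector (\<open>symmetric_invariant_subspace_eigenvector\<close>). Were
  \<open>B = (A - l)(A - m)\<close> nonzero, its range would contain an eigenvector \<open>Bz\<close> of \<open>A\<close>; then
  \<open>B(Bz) = 0\<close>, and the symmetry of \<open>B\<close> gives \<open>Bz \<bullet> Bz = z \<bullet> B(Bz) = 0\<close>, a contradiction.
\<close>

section \<open>The annihilating polynomial of a symmetric matrix\<close>

lemma symmetric_inner:
  fixes A :: "real ^ 'n ^ 'n"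
  assumes "transpose A = A"
  shows "x \<bullet> (A *v y) = (A *v x) \<bullet> y"
  using dot_lmul_matrix[of x A y] vector_transpose_matrix[of x A] assms by simp

text \<open>The eigenvector is a unit vector \<open>v\<close> of the subspace at which \<open>x \<bullet> Ax\<close> is maximal, with
  value \<open>M\<close>: the form \<open>q(x) = M (x \<bullet> x) - x \<bullet> Ax\<close> is nonnegative on the subspace and vanishes at
  \<open>v\<close>, so its derivative at \<open>v\<close> along \<open>h = Mv - Av\<close>, which is \<open>2 (h \<bullet> h)\<close>, must be zero.\<close>

lemma symmetric_invariant_subspace_eigenvector:
  fixes A :: "real ^ 'n ^ 'n"
  assumes sym: "transpose A = A"
    and S: "subspace S" and inv: "\<And>x. x \<in> S \<Longrightarrow> A *v x \<in> S"
    and z: "z \<in> S" "z \<noteq> 0"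
  obtains v M where "v \<in> S" "v \<noteq> 0" "A *v v = M *\<^sub>R v"
proof -
  define K where "K = sphere 0 1 \<inter> S"
  have "compact K"
    unfolding K_def using S by (intro compact_Int_closed closed_subspace) auto
  moreover have "(1 / norm z) *\<^sub>R z \<in> K"
    using z S unfolding K_def by (auto intro: subspace_scale)
  moreover have "continuous_on K (\<lambda>x. x \<bullet> (A *v x))"
    by (intro continuous_intros linear_continuous_on) simp
  ultimately obtain v where v: "v \<in> K" and vmax: "\<And>y. y \<in> K \<Longrightarrow> y \<bullet> (A *v y) \<le> v \<bullet> (A *v v)"
    using continuous_attains_sup[of K "\<lambda>x. x \<bullet> (A *v x)"] by blast
  define M where "M = v \<bullet> (A *v v)"
  define q where "q = (\<lambda>x. M * (x \<bullet> x) - x \<bullet> (A *v x))"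
  have vS: "v \<in> S" and vv: "v \<bullet> v = 1"
    using v by (auto simp: K_def dot_square_norm)
  have q_nonneg: "q x \<ge> 0" if x: "x \<in> S" for x
  proof (cases "x = 0")
    case True
    then show ?thesis by (simp add: q_def)
  next
    case False
    have "(1 / norm x) *\<^sub>R x \<in> K"
      using False x S unfolding K_def by (auto intro: subspace_scale)
    from vmax[OF this] have "(x \<bullet> (A *v x)) / (norm x)\<^sup>2 \<le> M"
      by (simp add: M_def matrix_vector_mult_scaleR power2_eq_square divide_inverse mult_ac)
    with False show ?thesis
      by (simp add: q_def dot_square_norm divide_le_eq)
  qed
  define h where "h = M *\<^sub>R v - A *v v"
  have hS: "h \<in> S"
    unfolding h_def by (intro subspace_diff subspace_scale S inv vS)
  have expand: "q (v + s *\<^sub>R h) = 2 * s * (h \<bullet> h) + s\<^sup>2 * q h" for s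
  proof -
    have "v \<bullet> (A *v h) = (A *v v) \<bullet> h" "h \<bullet> (A *v v) = (A *v v) \<bullet> h"
      by (rule symmetric_inner[OF sym], rule inner_commute)
    then have "q (v + s *\<^sub>R h) = 2 * s * (M * (v \<bullet> h) - (A *v v) \<bullet> h) + s\<^sup>2 * q h"
      using vv by (simp add: q_def M_def matrix_vector_right_distrib matrix_vector_mult_scaleR
          inner_add_left inner_add_right inner_commute[of h v] power2_eq_square algebra_simps)
    also have "M * (v \<bullet> h) - (A *v v) \<bullet> h = h \<bullet> h"
      unfolding h_def by (simp add: inner_diff_left)
    finally show ?thesis .
  qed
  have "h = 0"
  proof (rule ccontr)
    assume "h \<noteq> 0"
    then have a: "h \<bullet> h > 0" by simp
    have k: "q h \<ge> 0" by (rule q_nonneg[OF hS])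
    \<comment> \<open>The linear term dominates at a small negative step along \<open>h\<close>.\<close>
    define s where "s = - (h \<bullet> h) / (q h + 1)"
    have s: "s * (q h + 1) = - (h \<bullet> h)" "s < 0"
      using a k by (auto simp: s_def divide_neg_pos)
    have "0 \<le> q (v + s *\<^sub>R h)"
      by (intro q_nonneg subspace_add subspace_scale S vS hS)
    also have "\<dots> = s * (2 * (h \<bullet> h) + s * q h)"
      unfolding expand by (simp add: power2_eq_square algebra_simps)
    also have "2 * (h \<bullet> h) + s * q h = h \<bullet> h - s"
      using s(1) by (simp add: algebra_simps)
    also have "s * (h \<bullet> h - s) < 0"
      using s(2) a by (intro mult_neg_pos) linarith+
    finally show False by simp
  qed
  then have "A *v v = M *\<^sub>R v" by (simp add: h_def)
  moreover have "v \<noteq> 0" using vv by auto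
  ultimately show thesis using that vS by blast
qed

text \<open>The factors of \<open>B = (A - l)(A - m)\<close> commute with \<open>A\<close>, so the range of \<open>B\<close> is invariant and
  would, if nonzero, contain an eigenvector of \<open>A\<close>. Such a vector lies in the kernel of \<open>B\<close>, which
  is orthogonal to the range since \<open>B\<close> is symmetric.\<close>

lemma symmetric_two_eigenvalues_annihilated:
  fixes A :: "real ^ 'n ^ 'n"
  assumes sym: "transpose A = A" and ev: "eigenvalues A \<subseteq> {l, m}"
  shows "A *v (A *v x) = (l + m) *\<^sub>R (A *v x) - (l * m) *\<^sub>R x"
proof -
  define B where "B = (\<lambda>x. A *v (A *v x) - (l + m) *\<^sub>R (A *v x) + (l * m) *\<^sub>R x)"
  have lin: "linear B"
    unfolding B_def
    by (intro linearI)
      (simp_all add: matrix_vector_right_distrib matrix_vector_mult_scaleR algebra_simps)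
  have B_sym: "x \<bullet> B y = B x \<bullet> y" for x y
    by (simp add: B_def inner_add_right inner_diff_right inner_add_left inner_diff_left
        symmetric_inner[OF sym])
  have B_commute: "A *v B x = B (A *v x)" for x
    by (simp add: B_def matrix_vector_right_distrib matrix_vector_mult_diff_distrib
        matrix_vector_mult_scaleR)
  have "B z = 0" for z
  proof (rule ccontr)
    assume Bz: "B z \<noteq> 0"
    have "subspace (range B)"
      by (intro linear_subspace_image lin subspace_UNIV)
    moreover have "A *v x \<in> range B" if "x \<in> range B" for x
      using that B_commute by auto
    ultimately obtain v M where v: "v \<in> range B" "v \<noteq> 0" "A *v v = M *\<^sub>R v"
      using symmetric_invariant_subspace_eigenvector[OF sym _ _ rangeI[of B z] Bz] by blast
    then have "M = l \<or> M = m" using ev by (auto simp: eigenvalues_def)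
    then have "B v = 0"
      using v(3) by (auto simp: B_def matrix_vector_mult_scaleR algebra_simps)
    moreover obtain y where "v = B y" using v(1) by auto
    ultimately have "v \<bullet> v = 0" using B_sym[of y v] by simp
    with v(2) show False by simp
  qed
  from this[of x] show ?thesis by (simp add: B_def algebra_simps)
qed

section \<open>Positive definite quadratics and pairs of vectors\<close>

lemma quad_minimizer_if_grad_zero:
  fixes A :: "real ^ 'n ^ 'n"
  assumes A: "sym_pos_def A" and "grad A b x = 0"
  shows "is_minimizer (quad A b c) x"
proof -
  have "quad A b c x \<le> quad A b c y" for y
  proof -
    define h where "h = y - x"
    have y: "y = x + h" by (simp add: h_def)
    have "b = A *v x" using assms(2) by (simp add: grad_def)
    moreover have "x \<bullet> (A *v h) = (A *v x) \<bullet> h" "h \<bullet> (A *v x) = (A *v x) \<bullet> h"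
      using A by (auto simp: sym_pos_def_def intro: symmetric_inner inner_commute)
    ultimately have "quad A b c y = quad A b c x + (1/2) * (h \<bullet> (A *v h))"
      unfolding y quad_def
      by (simp add: matrix_vector_right_distrib inner_add_left inner_add_right algebra_simps)
    moreover have "h \<bullet> (A *v h) \<ge> 0"
      using A by (cases "h = 0") (auto simp: sym_pos_def_def less_imp_le)
    ultimately show ?thesis by simp
  qed
  then show ?thesis by (auto simp: is_arg_min_def not_less)
qed

lemma eigenvalue_pos:
  assumes "sym_pos_def A" "l \<in> eigenvalues A"
  shows "l > 0"
proof -
  obtain v where "v \<noteq> 0" "A *v v = l *\<^sub>R v"
    using assms(2) by (auto simp: eigenvalues_def)
  then have "l * (v \<bullet> v) > 0" "v \<bullet> v > 0"
    using assms(1) by (auto simp: sym_pos_def_def dest: spec[of _ v])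
  then show ?thesis by (simp add: zero_less_mult_iff)
qed

lemma lin_dep_scaleR:
  assumes "lin_dep u v" "u \<noteq> 0"
  obtains k where "v = k *\<^sub>R u"
proof (cases "u = v")
  case True
  then show thesis using that[of 1] by simp
next
  case False
  then have "dependent {v, u}" using assms(1) by (simp add: lin_dep_def insert_commute)
  then have "v \<in> span {u}"
    using False assms(2) independent_insert[of v "{u}"] by auto
  then show thesis using that by (auto simp: span_singleton)
qed

lemma not_lin_dep_coeffs:
  fixes u v :: "'a::real_vector"
  assumes nd: "\<not> lin_dep u v" and eq: "a *\<^sub>R u + d *\<^sub>R v = a' *\<^sub>R u + d' *\<^sub>R v"
  shows "a = a' \<and> d = d'"
proof -
  have ne: "u \<noteq> v" and ind: "independent {u, v}"
    using nd by (auto simp: lin_dep_def)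
  have "(a - a') *\<^sub>R u + (d - d') *\<^sub>R v = 0"
    using eq by (simp add: algebra_simps)
  then have "(\<Sum>x\<in>{u, v}. (if x = u then a - a' else d - d') *\<^sub>R x) = 0"
    using ne by simp
  from independentD[OF ind _ _ this] show ?thesis using ne by force
qed

section \<open>The first iteration\<close>

text \<open>The pair of coefficients is selected by a definite description, so the global minimizer must
  be known to correspond to exactly one pair; this is where independence is used.\<close>

lemma plane_minimizer_coeffs:
  assumes min: "\<And>x. is_minimizer f x \<longleftrightarrow> x = xs"
    and nd: "\<not> lin_dep g r" and xs: "x + a *\<^sub>R g + d *\<^sub>R r = xs"
  shows "(THE p. is_minimizer (\<lambda>(\<alpha>, \<beta>). f (x + \<alpha> *\<^sub>R g + \<beta> *\<^sub>R r) :: real) p) = (a, d)"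
proof (rule the_equality)
  have le: "f xs \<le> f y" for y
    using min[of xs] by (auto simp: is_arg_min_def not_less)
  show "is_minimizer (\<lambda>(\<alpha>, \<beta>). f (x + \<alpha> *\<^sub>R g + \<beta> *\<^sub>R r)) (a, d)"
    using le xs by (auto simp: is_arg_min_def not_less)
  fix p
  assume p: "is_minimizer (\<lambda>(\<alpha>, \<beta>). f (x + \<alpha> *\<^sub>R g + \<beta> *\<^sub>R r)) p"
  obtain a' d' where p_eq: "p = (a', d')" by fastforce
  have "f (x + a' *\<^sub>R g + d' *\<^sub>R r) \<le> f xs"
    using p xs[symmetric] unfolding p_eq by (auto simp: is_arg_min_def not_less)
  then have "is_minimizer f (x + a' *\<^sub>R g + d' *\<^sub>R r)"
    using le unfolding is_arg_min_def by (meson linorder_not_less order_trans)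
  then have "x + a' *\<^sub>R g + d' *\<^sub>R r = xs" using min by simp
  then have "a' *\<^sub>R g + d' *\<^sub>R r = a *\<^sub>R g + d *\<^sub>R r"
    using xs by (metis add.assoc add_left_cancel)
  with not_lin_dep_coeffs[OF nd] p_eq show "p = (a, d)" by blast
qed

text \<open>The case distinction is that of the iteration: either \<open>g\<close> is an eigenvector and the midpoint
  is the Newton point, or the Newton point lies in the search plane.\<close>

lemma iteration_reaches_minimizer:
  fixes A :: "real ^ 'n ^ 'n"
  assumes A: "sym_pos_def A"
    and min: "\<And>x. is_minimizer (quad A b c) x \<longleftrightarrow> x = xs"
    and ev: "eigenvalues A = {l, m}"
    and g0: "grad A b x \<noteq> 0"
  shows "\<exists>z. iteration A b c (\<lambda>xt. (xt, grad A b xt)) \<lparr>pt = x, gr = grad A b x, stopped = False\<rparr>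
    = Some \<lparr>pt = xs, gr = 0, stopped = z\<rparr>"
proof -
  define g where "g = grad A b x"
  define w where "w = A *v g"
  define t where "t = 2 * (norm g)\<^sup>2 / (g \<bullet> w)"
  define r where "r = g - t *\<^sub>R w"
  have g: "g \<noteq> 0" using g0 by (simp add: g_def)
  have gw: "g \<bullet> w > 0" using A g by (simp add: sym_pos_def_def w_def)
  have t: "t > 0" using g gw by (simp add: t_def)
  have grad_step: "grad A b (x + h) = g + A *v h" for h
    by (simp add: g_def grad_def matrix_vector_right_distrib)
  have xsI: "y = xs" if "grad A b y = 0" for y
    using quad_minimizer_if_grad_zero[OF A that] min by blast
  show ?thesis
  proof (cases "lin_dep g r")
    case True
    then obtain k where k: "r = k *\<^sub>R g" using lin_dep_scaleR g by blast
    have "t *\<^sub>R w = (1 - k) *\<^sub>R g" using k by (simp add: r_def algebra_simps)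
    then have "(1 / t) *\<^sub>R (t *\<^sub>R w) = (1 / t) *\<^sub>R ((1 - k) *\<^sub>R g)" by simp
    then have w_eq: "w = ((1 - k) / t) *\<^sub>R g" using t by simp
    have "2 * (g \<bullet> g) = t * (g \<bullet> w)"
      using gw by (simp add: t_def dot_square_norm)
    also have "g \<bullet> w = ((1 - k) / t) * (g \<bullet> g)"
      by (subst w_eq) simp
    finally have "(1 - k) = 2" using g t by simp
    with w_eq have "(t / 2) *\<^sub>R w = g" using t by simp
    then have "grad A b (x + (- (t / 2)) *\<^sub>R g) = 0"
      unfolding grad_step matrix_vector_mult_scaleR w_def by simp
    moreover have "x + (- (t / 2)) *\<^sub>R g = (1/2) *\<^sub>R (x + (x - t *\<^sub>R g))"
      by (simp add: algebra_simps scaleR_2[symmetric])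
    ultimately have mid: "grad A b ((1/2) *\<^sub>R (x + (x - t *\<^sub>R g))) = 0"
      by simp
    with xsI[OF this] True g show ?thesis
      unfolding iteration_def Let_def
      by (intro exI[of _ True])
        (simp add: g_def[symmetric] w_def[symmetric] t_def[symmetric] r_def[symmetric])
  next
    case False
    have lm: "l > 0" "m > 0" using eigenvalue_pos[OF A] ev by auto
    have ann: "A *v w = (l + m) *\<^sub>R w - (l * m) *\<^sub>R g"
      unfolding w_def using A ev
      by (intro symmetric_two_eigenvalues_annihilated) (auto simp: sym_pos_def_def)
    \<comment> \<open>The coefficients of the Newton step \<open>(w - (l + m) g) / (lm)\<close> after substituting
      \<open>w = (g - r) / t\<close>.\<close>
    define a where "a = (1 / t - (l + m)) / (l * m)"
    define d where "d = - (1 / t) / (l * m)"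
    have "a *\<^sub>R g + d *\<^sub>R r = (a + d) *\<^sub>R g - (d * t) *\<^sub>R w"
      by (simp add: r_def algebra_simps)
    also have "a + d = - (l + m) / (l * m)"
      by (simp add: a_def d_def diff_divide_distrib add_divide_distrib)
    also have "d * t = - (1 / (l * m))" using t by (simp add: d_def)
    finally have step: "a *\<^sub>R g + d *\<^sub>R r = (1 / (l * m)) *\<^sub>R (w - (l + m) *\<^sub>R g)"
      by (simp add: algebra_simps divide_inverse)
    have "A *v (w - (l + m) *\<^sub>R g) = - ((l * m) *\<^sub>R g)"
      by (simp add: matrix_vector_mult_diff_distrib matrix_vector_mult_scaleR ann
          w_def[symmetric])
    then have "A *v (a *\<^sub>R g + d *\<^sub>R r) = - g"
      using lm by (simp add: step matrix_vector_mult_scaleR)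
    then have grad0: "grad A b (x + a *\<^sub>R g + d *\<^sub>R r) = 0"
      by (simp add: add.assoc grad_step)
    note coeffs = plane_minimizer_coeffs[OF min False xsI[OF grad0]]
    show ?thesis
      using False g grad0 xsI[OF grad0] coeffs
      unfolding iteration_def Let_def
      by (intro exI[of _ False])
        (simp add: g_def[symmetric] w_def[symmetric] t_def[symmetric] r_def[symmetric])
  qed
qed

section \<open>Termination\<close>

lemma run_None_mono:
  assumes "run \<rho> A b c x0 j = None" "j \<ge> 1" "j \<le> k"
  shows "run \<rho> A b c x0 k = None"
  using assms(3)
proof (induction rule: dec_induct)
  case base
  show ?case by (rule assms(1))
next
  case (step n)
  then obtain i where "n = Suc i" using assms(2) by (cases n) auto
  with step show ?case by (cases "run \<rho> A b c x0 i") auto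
qed

text \<open>The rule \<open>\<rho>\<close> is arbitrary because it acts only from \<open>k = 1\<close> on, and a state with
  \<open>g\<^sub>1 = 0\<close> is already final.\<close>

lemma at_most_one_iteration_two_eigenvalues:
  fixes A :: "real ^ 'n ^ 'n"
  assumes A: "sym_pos_def A"
    and min: "\<And>x. is_minimizer (quad A b c) x \<longleftrightarrow> x = xs"
    and ev: "eigenvalues A = {l, m}"
  shows "at_most_one_iteration \<rho> A b c x0 xs"
proof (cases "grad A b x0 = 0")
  case True
  then have "x0 = xs" using quad_minimizer_if_grad_zero[OF A] min by blast
  moreover have "run \<rho> A b c x0 1 = None"
    using True by (simp add: iteration_def)
  ultimately show ?thesis
    using run_None_mono[of \<rho> A b c x0 1]
    by (auto simp: at_most_one_iteration_def iterate_def)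
next
  case False
  obtain z where first: "run \<rho> A b c x0 (Suc 0) = Some \<lparr>pt = xs, gr = 0, stopped = z\<rparr>"
    using iteration_reaches_minimizer[OF A min ev False] by auto
  then have "run \<rho> A b c x0 (Suc (Suc 0)) = None"
    by (simp add: iteration_def)
  then have "run \<rho> A b c x0 k = None" if "k \<ge> 2" for k
    using run_None_mono[of \<rho> A b c x0 "Suc (Suc 0)" k] that by simp
  with first show ?thesis
    by (simp add: at_most_one_iteration_def iterate_def)
qed

theorem theorem4p1:
  fixes A :: "real ^ 'n ^ 'n" and b :: "real ^ 'n" and c :: real and x_star x0 :: "real ^ 'n"
  assumes "sym_pos_def A"
    and "\<And>x. is_minimizer (quad A b c) x \<longleftrightarrow> x = x_star"
    and "card (eigenvalues A) = 1 \<or> card (eigenvalues A) = 2"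
  shows "at_most_one_iteration ME A b c x0 x_star \<and>
    (\<forall>\<theta>. 0 < \<theta> \<and> \<theta> \<le> 1 \<longrightarrow> at_most_one_iteration (RelaxME \<theta>) A b c x0 x_star) \<and>
    at_most_one_iteration MomME A b c x0 x_star"
proof -
  \<comment> \<open>A single eigenvalue is the case \<open>l = m\<close>.\<close>
  obtain l m where "eigenvalues A = {l, m}"
    using assms(3) by (metis card_1_singletonE card_2_iff insert_absorb2)
  then show ?thesis
    using at_most_one_iteration_two_eigenvalues[OF assms(1,2)] by blast
qed

end
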